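(* Let $F$ be a field and $A\in M_q(F)$ a square matrix whose characteristic polynomial splits over $F$. Let $\pmb{\lambda}_1,\dots,\pmb{\lambda}_p$ be the distinct elements of $\mathcal{S}^{\ast}$ such that $\pmb{\lambda}_j\pmb{\Lambda}_i$ appears, for some $i\ge0$, in the $\mathcal{P}$-canonical form of $A$ relative to $(\mathcal{S}^{\ast},\mathcal{T})$. Then the minimal polynomial of $A$ is $$m_A(X)=X^{t_0}\prod_{j=1}^{p}(X-\lambda_j)^{t_j},$$ where $t_0$ and $t_j$ ($1\le j\le p$) are, respectively, the greatest integers such that $\pmb{0}_{t_0-1}$ and $\pmb{\lambda}_j\pmb{\Lambda}_{t_j-1}$ appear in the $\mathcal{P}$-canonical form of $A$ relative to $(\mathcal{S}^{\ast},\mathcal{T})$ (with $t_0=0$ if no $\pmb{0}_i$ appears).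
   Context: $\mathcal{C}_F$ is the $F$-algebra of all sequences over $F$ indexed by $k\ge0$, with componentwise operations; sequences of $q\times q$ matrices over $F$ are identified with elements of $M_q(\mathcal{C}_F)$. For $\lambda\in F\setminus\{0\}$, $\pmb{\lambda}=(\lambda^k)_{k\ge0}$; $\mathcal{S}^{\ast}=\{\pmb{\lambda}:\lambda\in F,\lambda\ne0\}$; for $i\in\mathbb{N}$, $\pmb{0}_i$ is the sequence with $\pmb{0}_i(k)=\delta_{ik}$; $\mathcal{S}^{\circ}=\{\pmb{0}_i:i\ge0\}$. $F_{\mathcal{S}^{\ast}}$ and $F_{\mathcal{S}^{\circ}}$ are the $F$-spans of $\mathcal{S}^{\ast}$ and $\mathcal{S}^{\circ}$. For $i\ge0$, $\pmb{\Lambda}_i=(\binom{k}{i})_{k\ge0}$ (integers viewed in $F$), and $\mathcal{T}=\{\pmb{\Lambda}_i:i\ge0\}$. If the characteristic polynomial of $A$ splits over $F$, then $(A^k)_{k\ge0}$ can be written in exactly one way (up to zero terms) as $\pmb{N}(A)+\pmb{\mathcal{A}}_0\pmb{\Lambda}_0+\cdots+\pmb{\mathcal{A}}_l\pmb{\Lambda}_l$ with $\pmb{N}(A)\in M_q(F_{\mathcal{S}^{\circ}})$ and $\pmb{\mathcal{A}}_i\in M_q(F_{\mathcal{S}^{\ast}})$; this is the $\mathcal{P}$-canonical form of $A$ relative to $(\mathcal{S}^{\ast},\mathcal{T})$. Since the sequences $\pmb{0}_i$ and $\pmb{\lambda}\pmb{\Lambda}_i$ ($i\ge0$, $\pmb{\lambda}\in\mathcal{S}^{\ast}$)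 are linearly independent over $F$, this form expands uniquely as a finite combination of them with coefficients in $M_q(F)$; such a sequence "appears" in the form if its matrix coefficient is nonzero. *)

theory Defs
  imports "Jordan_Normal_Form.Char_Poly" "HOL-Library.Function_Algebras"
begin

text \<open>
  The algebra of sequences over \<open>F\<close> is the function type \<open>nat \<Rightarrow> 'a\<close> with the
  pointwise operations of \<^theory>\<open>HOL-Library.Function_Algebras\<close>, and matrices over it
  are of type \<open>(nat \<Rightarrow> 'a) mat\<close>.
\<close>

definition seq_scale :: "'a::field \<Rightarrow> (nat \<Rightarrow> 'a) \<Rightarrow> (nat \<Rightarrow> 'a)" where
  "seq_scale c s = (\<lambda>k. c * s k)"

global_interpretation cseq: vector_space "seq_scale :: 'a::field \<Rightarrow> (nat \<Rightarrow> 'a) \<Rightarrow> (nat \<Rightarrow> 'a)"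
  by standard (simp_all add: seq_scale_def fun_eq_iff algebra_simps)

definition geom_seq :: "'a::field \<Rightarrow> (nat \<Rightarrow> 'a)" where
  "geom_seq x = (\<lambda>k. x ^ k)"

definition zero_seq :: "nat \<Rightarrow> (nat \<Rightarrow> 'a::field)" where
  "zero_seq i = (\<lambda>k. if k = i then 1 else 0)"

definition Lambda_seq :: "nat \<Rightarrow> (nat \<Rightarrow> 'a::field)" where
  "Lambda_seq i = (\<lambda>k. of_nat (k choose i))"

definition S_star :: "(nat \<Rightarrow> 'a::field) set" where
  "S_star = {geom_seq x | x. x \<noteq> 0}"

definition S_circ :: "(nat \<Rightarrow> 'a::field) set" where
  "S_circ = range zero_seq"

definition T_set :: "(nat \<Rightarrow> 'a::field) set" where
  "T_set = range Lambda_seq"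

definition mats_over :: "nat \<Rightarrow> 'b set \<Rightarrow> 'b mat set" where
  "mats_over q V = {X \<in> carrier_mat q q. elements_mat X \<subseteq> V}"

definition power_seq_mat :: "'a::field mat \<Rightarrow> (nat \<Rightarrow> 'a) mat" where
  "power_seq_mat A = mat (dim_row A) (dim_row A) (\<lambda>(r, c). (\<lambda>k. (A ^\<^sub>m k) $$ (r, c)))"

text \<open>
  A form \<open>N + B 0 \<Lambda>\<^sub>0 + \<dots> + B l \<Lambda>\<^sub>l\<close> is encoded by \<open>N\<close> and a finitely supported family \<open>B\<close>,
  so that two forms differing only by zero terms have the same code.
\<close>

definition pform_support :: "nat \<Rightarrow> (nat \<Rightarrow> (nat \<Rightarrow> 'a::field) mat) \<Rightarrow> nat set" where
  "pform_support q B = {i. B i \<noteq> 0\<^sub>m q q}"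

definition pform_value ::
  "nat \<Rightarrow> (nat \<Rightarrow> 'a::field) mat \<times> (nat \<Rightarrow> (nat \<Rightarrow> 'a) mat) \<Rightarrow> (nat \<Rightarrow> 'a) mat" where
  "pform_value q = (\<lambda>(N, B). N + mat q q (\<lambda>(r, c).
      \<Sum>i\<in>pform_support q B. (Lambda_seq i \<cdot>\<^sub>m B i) $$ (r, c)))"

definition is_P_canonical_form ::
  "'a::field mat \<Rightarrow> (nat \<Rightarrow> 'a) mat \<times> (nat \<Rightarrow> (nat \<Rightarrow> 'a) mat) \<Rightarrow> bool" where
  "is_P_canonical_form A = (\<lambda>(N, B).
     N \<in> mats_over (dim_row A) (cseq.span S_circ) \<and>
     (\<forall>i. B i \<in> mats_over (dim_row A) (cseq.span S_star)) \<and>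
     finite (pform_support (dim_row A) B) \<and>
     power_seq_mat A = pform_value (dim_row A) (N, B))"

definition P_canonical_form ::
  "'a::field mat \<Rightarrow> (nat \<Rightarrow> 'a) mat \<times> (nat \<Rightarrow> (nat \<Rightarrow> 'a) mat)" where
  "P_canonical_form A = (THE f. is_P_canonical_form A f)"

definition P_basis :: "(nat \<Rightarrow> 'a::field) set" where
  "P_basis = S_circ \<union> {s * \<tau> | s \<tau>. s \<in> S_star \<and> \<tau> \<in> T_set}"

text \<open>
  The matrix coefficient of a basis sequence collects its scalar coefficients in the entries.
\<close>

definition P_coeff :: "'a::field mat \<Rightarrow> (nat \<Rightarrow> 'a) \<Rightarrow> 'a mat" where
  "P_coeff A s = map_mat (\<lambda>x. cseq.representation P_basis x s)
     (pform_value (dim_row A) (P_canonical_form A))"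

definition appears :: "'a::field mat \<Rightarrow> (nat \<Rightarrow> 'a) \<Rightarrow> bool" where
  "appears A s \<longleftrightarrow> s \<in> P_basis \<and> P_coeff A s \<noteq> 0\<^sub>m (dim_row A) (dim_row A)"

definition splits :: "'a::field poly \<Rightarrow> bool" where
  "splits p \<longleftrightarrow> (\<exists>c as. p = Polynomial.smult c (\<Prod>a\<leftarrow>as. [:- a, 1:]))"

definition poly_mat :: "'a::field poly \<Rightarrow> 'a mat \<Rightarrow> 'a mat" where
  "poly_mat p A = mat (dim_row A) (dim_row A) (\<lambda>(r, c).
     \<Sum>i\<le>degree p. coeff p i * (A ^\<^sub>m i) $$ (r, c))"

definition min_poly :: "'a::field mat \<Rightarrow> 'a poly" where
  "min_poly A = (THE p. lead_coeff p = 1 \<and> poly_mat p A = 0\<^sub>m (dim_row A) (dim_row A) \<and>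
     (\<forall>g. g \<noteq> 0 \<and> poly_mat g A = 0\<^sub>m (dim_row A) (dim_row A) \<longrightarrow> degree p \<le> degree g))"

end

theory Submission
  imports Defs
begin

text \<open>
  Let \<open>E\<close> be the left shift on sequences. The entries of \<open>p(A) A\<^sup>k\<close>, as sequences in \<open>k\<close>, arise by
  applying \<open>p(E)\<close> to the entries of \<open>A\<^sup>k\<close>; so \<open>p(A) = 0\<close> if and only if \<open>p(E)\<close> kills all entry
  sequences of \<open>A\<close> (\<open>poly_mat_eq_0_iff\<close>).

  The sequences \<open>a\<^sup>k (k choose i)\<close> for \<open>a \<noteq> 0\<close>, together with the unit sequences for \<open>a = 0\<close>, are chains
  of generalised eigenvectors of \<open>E\<close>: up to a nonzero factor, \<open>E - a\<close> takes the \<open>i\<close>-th one to the one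
  before it, and it kills the first. It follows that they are linearly independent
  (\<open>independent_P_basis\<close>), and that their span contains every sequence killed by a product of linear
  factors in \<open>E\<close> (\<open>in_span_P_basis_if_killed\<close>). By Cayley--Hamilton (\<open>shift_act_char_poly\<close>) the entry sequences of
  \<open>A\<close> are of this kind; so the canonical form exists, it is unique, and a basis sequence appears in it
  exactly when it has a nonzero coordinate in some entry sequence (\<open>appears_iff\<close>).

  Finally, \<open>p(E)\<close> kills a combination of basis sequences if and only if \<open>(X - a)\<^bsup>i+1\<^esup>\<close> divides \<open>p\<close> whenever
  the \<open>i\<close>-th sequence for \<open>a\<close> has a nonzero coefficient (\<open>shift_act_pseq_eq_0\<close>,
  \<open>linear_power_dvd_if_killed\<close>). The annihilators of \<open>A\<close> are therefore the multiples of the product of the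
  \<open>(X - a)\<^sup>t\<close>, where \<open>t - 1\<close> is the greatest index that appears for \<open>a\<close>.
\<close>

section \<open>Polynomials acting on sequences through the shift\<close>

text \<open>
  The left shift \<open>E\<close> on sequences.
\<close>

definition shift_seq :: "(nat \<Rightarrow> 'a::field) \<Rightarrow> (nat \<Rightarrow> 'a)" where
  "shift_seq s = (\<lambda>k. s (Suc k))"

text \<open>
  The sequence \<open>p(E) s\<close>: the action of the polynomial \<open>p\<close>, evaluated at the shift \<open>E\<close>,
  on \<open>s\<close>. It makes the sequences into a module over the polynomial ring.
\<close>

definition shift_act :: "'a::field poly \<Rightarrow> (nat \<Rightarrow> 'a) \<Rightarrow> (nat \<Rightarrow> 'a)" where
  "shift_act p s = (\<lambda>k. \<Sum>i\<le>degree p. coeff p i * s (k + i))"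

lemma shift_act_bound:
  assumes "degree p \<le> n"
  shows "shift_act p s k = (\<Sum>i\<le>n. coeff p i * s (k + i))"
  unfolding shift_act_def using assms
  by (intro sum.mono_neutral_left) (auto simp: coeff_eq_0)

lemma shift_act_0 [simp]: "shift_act 0 s = 0"
  by (simp add: shift_act_def fun_eq_iff)

lemma shift_act_pCons:
  "shift_act (pCons c p) s = seq_scale c s + shift_seq (shift_act p s)"
proof
  fix k
  have "shift_act (pCons c p) s k = (\<Sum>i\<le>Suc (degree p). coeff (pCons c p) i * s (k + i))"
    by (rule shift_act_bound) (simp add: degree_pCons_le)
  also have "\<dots> = c * s k + shift_act p s (Suc k)"
    by (subst sum.atMost_Suc_shift) (simp add: shift_act_def)
  finally show "shift_act (pCons c p) s k = (seq_scale c s + shift_seq (shift_act p s)) k"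
    by (simp add: seq_scale_def shift_seq_def)
qed

lemma shift_seq_0 [simp]: "shift_seq 0 = 0"
  by (simp add: shift_seq_def fun_eq_iff)

lemma shift_seq_add: "shift_seq (s + s') = shift_seq s + shift_seq s'"
  by (simp add: shift_seq_def fun_eq_iff)

lemma shift_seq_scale: "shift_seq (seq_scale c s) = seq_scale c (shift_seq s)"
  by (simp add: shift_seq_def seq_scale_def fun_eq_iff)

lemma shift_act_linear_poly:
  "shift_act [:- b, 1:] s = shift_seq s - seq_scale b s"
  by (simp add: shift_act_pCons fun_eq_iff seq_scale_def shift_seq_def)

lemma shift_act_one [simp]: "shift_act 1 s = s"
  by (simp add: shift_act_def fun_eq_iff)

lemma shift_act_add_poly: "shift_act (p + p') s = shift_act p s + shift_act p' s"
proof
  fix k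
  define n where "n = max (degree p) (degree p')"
  have "degree (p + p') \<le> n" "degree p \<le> n" "degree p' \<le> n"
    by (auto simp: n_def degree_add_le_max)
  then show "shift_act (p + p') s k = (shift_act p s + shift_act p' s) k"
    by (simp add: shift_act_bound sum.distrib algebra_simps)
qed

lemma shift_act_sum_poly: "shift_act (\<Sum>i\<in>I. f i) s = (\<Sum>i\<in>I. shift_act (f i) s)"
  by (induction I rule: infinite_finite_induct) (simp_all only: sum.infinite sum.empty sum.insert shift_act_0 shift_act_add_poly not_False_eq_True)

lemma shift_act_smult: "shift_act (Polynomial.smult c p) s = seq_scale c (shift_act p s)"
proof
  fix k
  show "shift_act (Polynomial.smult c p) s k = seq_scale c (shift_act p s) k"
    by (subst shift_act_bound[OF degree_smult_le])
      (simp add: seq_scale_def shift_act_def sum_distrib_left mult.assoc)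
qed

lemma shift_act_add: "shift_act p (s + s') = shift_act p s + shift_act p s'"
  by (simp add: shift_act_def fun_eq_iff sum.distrib algebra_simps)

lemma shift_act_scale: "shift_act p (seq_scale c s) = seq_scale c (shift_act p s)"
  by (simp add: shift_act_def seq_scale_def fun_eq_iff sum_distrib_left mult_ac)

lemma shift_act_0_right [simp]: "shift_act p 0 = 0"
  by (simp add: shift_act_def fun_eq_iff)

lemma shift_act_sum: "shift_act p (\<Sum>i\<in>I. f i) = (\<Sum>i\<in>I. shift_act p (f i))"
  by (induction I rule: infinite_finite_induct) (simp_all only: sum.infinite sum.empty sum.insert shift_act_0_right shift_act_add not_False_eq_True)

lemma shift_act_mult: "shift_act (p * p') s = shift_act p (shift_act p' s)"
proof (induction p)
  case (pCons c p)
  have "shift_act (pCons c p * p') s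
      = seq_scale c (shift_act p' s) + (seq_scale 0 s + shift_seq (shift_act (p * p') s))"
    by (simp only: mult_pCons_left shift_act_add_poly shift_act_smult shift_act_pCons)
  then show ?case
    using pCons.IH by (simp add: shift_act_pCons)
qed simp

lemma shift_act_dvd:
  assumes "p dvd p'" "shift_act p s = 0"
  shows "shift_act p' s = 0"
proof -
  obtain r where "p' = r * p"
    using assms(1) by (metis dvd_def mult.commute)
  then show ?thesis
    by (simp add: shift_act_mult assms(2))
qed

section \<open>The basis of sequences\<close>

text \<open>
  A common parametrisation of the two kinds of basis sequences: the generalised eigenvectors of
  the shift for the eigenvalue \<open>a\<close>. For \<open>a \<noteq> 0\<close> they are the sequences
  \<open>k \<mapsto> a\<^sup>k (k choose i)\<close>; for \<open>a = 0\<close>, where these degenerate, the unit sequences take their place.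
\<close>

definition pseq :: "'a::field \<Rightarrow> nat \<Rightarrow> (nat \<Rightarrow> 'a)" where
  "pseq a i = (if a = 0 then zero_seq i else geom_seq a * Lambda_seq i)"

text \<open>
  The factor by which \<open>E - a\<close> carries \<open>pseq a i\<close> to \<open>pseq a (i - 1)\<close>, for \<open>i \<ge> 1\<close>. It never vanishes,
  whatever the characteristic of the field.
\<close>

definition pfac :: "'a::field \<Rightarrow> 'a" where
  "pfac a = (if a = 0 then 1 else a)"

lemma pfac_nonzero [simp]: "pfac a \<noteq> 0"
  by (simp add: pfac_def)

lemma P_basis_eq: "P_basis = range (\<lambda>(a, i). pseq a i)"
proof (intro subset_antisym subsetI)
  fix s :: "nat \<Rightarrow> 'a"
  assume "s \<in> P_basis"
  then consider i where "s = zero_seq i" | a i where "a \<noteq> 0" "s = geom_seq a * Lambda_seq i"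
    by (auto simp: P_basis_def S_circ_def S_star_def T_set_def)
  then show "s \<in> range (\<lambda>(a, i). pseq a i)"
  proof cases
    case (1 i)
    then show ?thesis by (intro image_eqI[of _ _ "(0, i)"]) (auto simp: pseq_def)
  next
    case (2 a i)
    then show ?thesis by (intro image_eqI[of _ _ "(a, i)"]) (auto simp: pseq_def)
  qed
next
  fix s :: "nat \<Rightarrow> 'a"
  assume "s \<in> range (\<lambda>(a, i). pseq a i)"
  then obtain a i where s: "s = pseq a i"
    by auto
  show "s \<in> P_basis"
  proof (cases "a = 0")
    case True
    then show ?thesis by (simp add: s pseq_def P_basis_def S_circ_def)
  next
    case False
    then have "s = geom_seq a * Lambda_seq i" "geom_seq a \<in> S_star" "Lambda_seq i \<in> T_set"
      by (auto simp: s pseq_def S_star_def T_set_def)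
    then show ?thesis unfolding P_basis_def by blast
  qed
qed

lemma pseq_in_P_basis [simp]: "pseq a i \<in> P_basis"
  unfolding P_basis_eq by (rule image_eqI[of _ _ "(a, i)"]) auto

lemma pseq_0_0 [simp]: "pseq a 0 0 = 1"
  by (simp add: pseq_def zero_seq_def geom_seq_def Lambda_seq_def)

lemma shift_seq_pseq:
  "shift_seq (pseq a i) =
     seq_scale a (pseq a i) + (if i = 0 then 0 else seq_scale (pfac a) (pseq a (i - 1)))"
  by (cases i)
    (auto simp: fun_eq_iff shift_seq_def seq_scale_def pseq_def pfac_def zero_seq_def
      geom_seq_def Lambda_seq_def algebra_simps)

lemma shift_act_linear_pseq:
  "shift_act [:- b, 1:] (pseq a i) =
     seq_scale (a - b) (pseq a i) + (if i = 0 then 0 else seq_scale (pfac a) (pseq a (i - 1)))"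
  unfolding shift_act_linear_poly shift_seq_pseq
  by (auto simp: fun_eq_iff seq_scale_def algebra_simps)

lemma shift_act_power_pseq:
  "shift_act ([:- a, 1:] ^ n) (pseq a i) =
     (if i < n then 0 else seq_scale (pfac a ^ n) (pseq a (i - n)))"
proof (induction n)
  case (Suc n)
  have "shift_act ([:- a, 1:] ^ Suc n) (pseq a i)
      = shift_act [:- a, 1:] (shift_act ([:- a, 1:] ^ n) (pseq a i))"
    by (simp only: power_Suc shift_act_mult)
  also have "\<dots> = (if i < Suc n then 0 else seq_scale (pfac a ^ Suc n) (pseq a (i - Suc n)))"
  proof (cases "i < n")
    case False
    then show ?thesis
      unfolding Suc.IH
      by (simp add: shift_act_scale shift_act_linear_pseq cseq.scale_scale mult.commute)
  qed (simp add: Suc.IH flip: zero_fun_def)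
  finally show ?case .
qed (simp add: seq_scale_def)

lemma shift_act_pseq_eq_0:
  assumes "[:- a, 1:] ^ Suc i dvd p"
  shows "shift_act p (pseq a i) = 0"
  using assms by (rule shift_act_dvd) (simp only: shift_act_power_pseq lessI if_True)

lemma shift_act_pseq_0: "shift_act p (pseq a 0) = seq_scale (poly p a) (pseq a 0)"
proof (induction p)
  case (pCons c p)
  have "shift_act (pCons c p) (pseq a 0)
      = seq_scale c (pseq a 0) + seq_scale (poly p a) (seq_scale a (pseq a 0))"
    by (simp add: shift_act_pCons pCons.IH shift_seq_scale shift_seq_pseq)
  then show ?case
    by (simp add: fun_eq_iff seq_scale_def algebra_simps)
qed (simp add: fun_eq_iff seq_scale_def)

text \<open>
  If \<open>m\<close> is the largest index with a nonzero coefficient at the eigenvalue \<open>a\<close>, then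
  \<open>(X - a)\<^sup>m\<close> times high powers of the \<open>X - b\<close> for the other eigenvalues \<open>b\<close> kills every term of the
  sum except the one at \<open>(a, m)\<close>, which becomes a nonzero multiple of \<open>pseq a 0\<close>.
\<close>

lemma pseq_family_independent:
  assumes fin: "finite K"
    and sum0: "(\<Sum>(a, i)\<in>K. seq_scale (c (a, i)) (pseq a i)) = 0"
    and v: "v \<in> K"
  shows "c v = 0"
proof (rule ccontr)
  assume "c v \<noteq> 0"
  define a where "a = fst v"
  define I where "I = {i. (a, i) \<in> K \<and> c (a, i) \<noteq> 0}"
  define m where "m = Max I"
  have "I \<subseteq> snd ` K"
    by (force simp: I_def)
  then have "finite I"
    using fin finite_surj by blast
  moreover have "snd v \<in> I"
    using v \<open>c v \<noteq> 0\<close> by (simp add: I_def a_def)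
  ultimately have mI: "m \<in> I" and mMax: "\<And>i. i \<in> I \<Longrightarrow> i \<le> m"
    unfolding m_def by (auto intro: Max_in)
  define N where "N = Suc (Max (snd ` K))"
  define r where "r = (\<Prod>b\<in>fst ` K - {a}. [:- b, 1:] ^ N)"
  have finB: "finite (fst ` K - {a})" using fin by simp
  have ra: "poly r a \<noteq> 0"
    using finB by (auto simp: r_def poly_prod)
  \<comment> \<open>Every other term is killed: by the power of the factor for its own eigenvalue, or by \<open>(X - a)\<^sup>m\<close>.\<close>
  have kill: "shift_act (r * [:- a, 1:] ^ m) (seq_scale (c (b, i)) (pseq b i)) = 0"
    if "(b, i) \<in> K" "(b, i) \<noteq> (a, m)" for b i
  proof (cases "b = a")
    case True
    show ?thesis
    proof (cases "c (b, i) = 0")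
      case False
      then have "i < m"
        using that True mMax[of i] by (force simp: I_def)
      then show ?thesis
        by (simp add: True shift_act_scale shift_act_mult shift_act_power_pseq)
    qed (simp add: shift_act_scale)
  next
    case False
    have "i \<le> Max (snd ` K)"
      using that(1) fin by (force intro: Max_ge)
    then have "[:- b, 1:] ^ Suc i dvd [:- b, 1:] ^ N"
      unfolding N_def by (intro le_imp_power_dvd) simp
    also have "\<dots> dvd r"
      unfolding r_def using that(1) False finB by (intro dvd_prodI) force+
    finally have "[:- b, 1:] ^ Suc i dvd r * [:- a, 1:] ^ m"
      by (rule dvd_mult2)
    then show ?thesis
      by (simp add: shift_act_scale shift_act_pseq_eq_0)
  qed
  have "0 = shift_act (r * [:- a, 1:] ^ m) (\<Sum>(b, i)\<in>K. seq_scale (c (b, i)) (pseq b i))"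
    by (simp add: sum0)
  also have "\<dots> = (\<Sum>(b, i)\<in>K. shift_act (r * [:- a, 1:] ^ m) (seq_scale (c (b, i)) (pseq b i)))"
    by (simp add: shift_act_sum case_prod_unfold)
  also have "\<dots> = (\<Sum>(b, i)\<in>{(a, m)}. shift_act (r * [:- a, 1:] ^ m) (seq_scale (c (b, i)) (pseq b i)))"
    using mI fin kill by (intro sum.mono_neutral_right) (auto simp: I_def)
  also have "\<dots> = seq_scale (c (a, m) * pfac a ^ m * poly r a) (pseq a 0)"
    by (simp add: shift_act_scale shift_act_mult shift_act_power_pseq shift_act_pseq_0)
  finally have "seq_scale (c (a, m) * pfac a ^ m * poly r a) (pseq a 0) 0 = 0"
    by (simp only: zero_fun_apply)
  then show False
    using mI ra by (simp add: seq_scale_def I_def)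
qed

lemma pseq_eq_iff [simp]: "pseq a i = pseq b j \<longleftrightarrow> a = b \<and> i = j"
proof (rule iffI, rule ccontr)
  assume eq: "pseq a i = pseq b j" and ne: "\<not> (a = b \<and> i = j)"
  have "(\<Sum>(x, y)\<in>{(a, i), (b, j)}. seq_scale (if (x, y) = (a, i) then 1 else - 1) (pseq x y)) = 0"
  proof -
    have "(\<Sum>(x, y)\<in>{(a, i), (b, j)}. seq_scale (if (x, y) = (a, i) then 1 else - 1) (pseq x y))
        = seq_scale 1 (pseq a i) + seq_scale (- 1) (pseq b j)"
      using ne by auto
    then show ?thesis
      by (simp add: eq)
  qed
  from pseq_family_independent[OF _ this, of "(a, i)"] show False
    by simp
qed simp

lemma independent_P_basis: "cseq.independent (P_basis :: (nat \<Rightarrow> 'a::field) set)"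
proof
  assume "cseq.dependent (P_basis :: (nat \<Rightarrow> 'a) set)"
  then obtain T f and v :: "nat \<Rightarrow> 'a" where T: "finite T" "T \<subseteq> P_basis"
    and s: "(\<Sum>v\<in>T. seq_scale (f v) v) = 0" and v: "v \<in> T" "f v \<noteq> 0"
    unfolding cseq.dependent_explicit by blast
  let ?g = "\<lambda>(a, i). pseq a i :: nat \<Rightarrow> 'a"
  define K where "K = ?g -` T"
  \<comment> \<open>The family is injective, so a linear relation among the vectors is one among the indices.\<close>
  have inj: "inj ?g"
    by (auto simp: inj_def)
  have TK: "T = ?g ` K"
    using T(2) unfolding K_def P_basis_eq by auto
  have fin: "finite K"
    unfolding K_def using T(1) inj by (rule finite_vimageI)
  have "(\<Sum>(a, i)\<in>K. seq_scale (f (?g (a, i))) (pseq a i)) = (\<Sum>v\<in>T. seq_scale (f v) v)"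
    unfolding TK using inj
    by (subst sum.reindex) (auto simp: inj_on_def case_prod_unfold)
  then have sK: "(\<Sum>(a, i)\<in>K. seq_scale ((f \<circ> ?g) (a, i)) (pseq a i)) = 0"
    using s by simp
  obtain w where w: "w \<in> K" "v = ?g w"
    using v(1) TK by blast
  show False
    using pseq_family_independent[OF fin sK w(1)] v(2) w(2) by simp
qed

section \<open>Sequences killed by a split polynomial\<close>

text \<open>
  On the span of the basis, \<open>E - b\<close> is onto: it is a nonzero scalar plus a locally nilpotent map on the
  chains for \<open>a \<noteq> b\<close>, and it lowers the index along the
  endless chain for \<open>b\<close>.
\<close>

lemma shift_act_linear_surj:
  assumes "s \<in> cseq.span P_basis"
  shows "\<exists>w\<in>cseq.span P_basis. shift_act [:- b, 1:] w = s"
  using assms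
proof (induction rule: cseq.span_induct_alt)
  case base
  then show ?case
    \<comment> \<open>The flipped equation folds back zero sequences that the simplifier has eta-expanded.\<close>
    by (intro bexI[of _ 0]) (auto simp: cseq.span_zero simp flip: zero_fun_def)
next
  case (step c x y)
  obtain w where w: "w \<in> cseq.span P_basis" "shift_act [:- b, 1:] w = y"
    using step by blast
  obtain a i where x: "x = pseq a i"
    using step(1) unfolding P_basis_eq by auto
  have "\<exists>v\<in>cseq.span P_basis. shift_act [:- b, 1:] v = pseq a i"
  proof (cases "a = b")
    case True
    have "shift_act [:- b, 1:] (seq_scale (1 / pfac b) (pseq b (Suc i))) = pseq b i"
      unfolding shift_act_scale shift_act_linear_pseq by (simp add: fun_eq_iff seq_scale_def)
    then show ?thesis
      using True by (metis cseq.span_base cseq.span_scale pseq_in_P_basis)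
  next
    case False
    show ?thesis
    proof (induction i)
      case 0
      have "shift_act [:- b, 1:] (seq_scale (1 / (a - b)) (pseq a 0)) = pseq a 0"
        unfolding shift_act_scale shift_act_linear_pseq
        using False by (simp add: fun_eq_iff seq_scale_def)
      then show ?case
        by (metis cseq.span_base cseq.span_scale pseq_in_P_basis)
    next
      case (Suc i)
      then obtain v where v: "v \<in> cseq.span P_basis" "shift_act [:- b, 1:] v = pseq a i"
        by blast
      \<comment> \<open>Solve \<open>(E - b) (pseq a (i + 1)) = (a - b) pseq a (i + 1) + pfac a pseq a i\<close> for the first term.\<close>
      let ?v = "seq_scale (1 / (a - b)) (pseq a (Suc i) + seq_scale (- pfac a) v)"
      have "shift_act [:- b, 1:] ?v = pseq a (Suc i)"
        unfolding shift_act_scale shift_act_add v(2) shift_act_linear_pseq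
        using False by (simp add: fun_eq_iff seq_scale_def)
      moreover have "?v \<in> cseq.span P_basis"
        by (intro cseq.span_scale cseq.span_add v(1) cseq.span_base pseq_in_P_basis)
      ultimately show ?case by blast
    qed
  qed
  then obtain v where v: "v \<in> cseq.span P_basis" "shift_act [:- b, 1:] v = x"
    using x by blast
  show ?case
  proof
    show "shift_act [:- b, 1:] (seq_scale c v + w) = seq_scale c x + y"
      by (simp only: shift_act_add shift_act_scale v w)
    show "seq_scale c v + w \<in> cseq.span P_basis"
      by (intro cseq.span_add cseq.span_scale v(1) w(1))
  qed
qed

lemma shift_act_linear_kernel:
  assumes "shift_act [:- b, 1:] s = 0"
  shows "s = seq_scale (s 0) (pseq b 0)"
proof
  fix k
  have step: "s (Suc k) = b * s k" for k
    using assms by (simp add: shift_act_linear_poly fun_eq_iff shift_seq_def seq_scale_def)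
  have "s k = s 0 * b ^ k"
    by (induction k) (simp_all add: step)
  then show "s k = seq_scale (s 0) (pseq b 0) k"
    by (cases k) (simp_all add: seq_scale_def pseq_def zero_seq_def geom_seq_def Lambda_seq_def)
qed

text \<open>
  By induction on the linear factors: the shift-invariant span contains a preimage under \<open>E - b\<close>
  of each of its elements, as well as the kernel of \<open>E - b\<close>.
\<close>

lemma in_span_P_basis_if_killed:
  assumes "shift_act (\<Prod>a\<leftarrow>as. [:- a, 1:]) s = 0"
  shows "s \<in> cseq.span P_basis"
  using assms
proof (induction as arbitrary: s)
  case Nil
  then show ?case by (simp add: cseq.span_zero flip: zero_fun_def)
next
  case (Cons b as)
  have "shift_act (\<Prod>a\<leftarrow>as. [:- a, 1:]) (shift_act [:- b, 1:] s) = 0"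
  proof -
    have "(\<Prod>a\<leftarrow>b # as. [:- a, 1:]) = (\<Prod>a\<leftarrow>as. [:- a, 1:]) * [:- b, 1:]"
      by (simp only: list.map prod_list.Cons mult.commute)
    then show ?thesis
      using Cons.prems by (simp only: shift_act_mult)
  qed
  then have "shift_act [:- b, 1:] s \<in> cseq.span P_basis"
    by (rule Cons.IH)
  then obtain w where w: "w \<in> cseq.span P_basis" "shift_act [:- b, 1:] w = shift_act [:- b, 1:] s"
    using shift_act_linear_surj by blast
  have "shift_act [:- b, 1:] (s + seq_scale (- 1) w) = 0"
    by (simp only: shift_act_add shift_act_scale w) (simp add: fun_eq_iff seq_scale_def)
  then obtain c where c: "s + seq_scale (- 1) w = seq_scale c (pseq b 0)"
    using shift_act_linear_kernel by blast
  have "s = (s + seq_scale (- 1) w) + w"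
    by (simp add: fun_eq_iff seq_scale_def)
  then show ?case
    unfolding c by (metis cseq.span_add cseq.span_scale w(1) cseq.span_base pseq_in_P_basis)
qed

section \<open>Coordinates\<close>

text \<open>
  The coefficient of the basis sequence \<open>v\<close> in \<open>s\<close>; it is meaningful for \<open>s\<close> in the span of the
  basis, and \<open>0\<close> if \<open>v\<close> is not in the basis.
\<close>

abbreviation coord :: "(nat \<Rightarrow> 'a::field) \<Rightarrow> (nat \<Rightarrow> 'a) \<Rightarrow> 'a" where
  "coord s v \<equiv> cseq.representation P_basis s v"

lemma coord_pseq: "coord (pseq b j) (pseq a i) = (if a = b \<and> i = j then 1 else 0)"
  by (simp add: cseq.representation_basis[OF independent_P_basis])

lemma coord_add:
  assumes "s \<in> cseq.span P_basis" "s' \<in> cseq.span P_basis"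
  shows "coord (s + s') v = coord s v + coord s' v"
  by (simp add: cseq.representation_add[OF independent_P_basis assms(2) assms(1)])

lemma coord_scale:
  assumes "s \<in> cseq.span P_basis"
  shows "coord (seq_scale c s) v = c * coord s v"
  by (simp add: cseq.representation_scale[OF independent_P_basis assms])

lemma coord_sum:
  assumes "\<And>i. i \<in> I \<Longrightarrow> f i \<in> cseq.span P_basis"
  shows "coord (\<Sum>i\<in>I. f i) v = (\<Sum>i\<in>I. coord (f i) v)"
  by (simp add: cseq.representation_sum[OF independent_P_basis assms])

lemma coord_expansion:
  assumes "s \<in> cseq.span P_basis"
  shows "s = (\<Sum>v | coord s v \<noteq> 0. seq_scale (coord s v) v)"
  using cseq.sum_nonzero_representation_eq[OF independent_P_basis assms] by simp

lemma coord_eqI: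
  assumes "s \<in> cseq.span P_basis" "s' \<in> cseq.span P_basis"
    and "\<And>a i. coord s (pseq a i) = coord s' (pseq a i)"
  shows "s = s'"
proof -
  have "coord s v = coord s' v" for v
  proof (cases "v \<in> P_basis")
    case True
    then show ?thesis using assms(3) unfolding P_basis_eq by auto
  next
    case False
    then show ?thesis using cseq.representation_ne_zero by metis
  qed
  then show ?thesis
    using coord_expansion[OF assms(1)] coord_expansion[OF assms(2)] by simp
qed

lemma span_coord_induct [consumes 1, case_names zero step]:
  assumes "s \<in> cseq.span P_basis"
    and "P 0"
    and "\<And>c b j w. w \<in> cseq.span P_basis \<Longrightarrow> P w \<Longrightarrow> P (seq_scale c (pseq b j) + w)"
  shows "P s"
proof -
  have "s \<in> cseq.span P_basis \<and> P s"
    using assms(1)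
  proof (induction rule: cseq.span_induct_alt)
    case base
    then show ?case using assms(2) by (simp add: cseq.span_zero flip: zero_fun_def)
  next
    case (step c x y)
    obtain a i where x: "x = pseq a i"
      using step(1) unfolding P_basis_eq by auto
    have "seq_scale c (pseq a i) + y \<in> cseq.span P_basis"
      using step(2) by (simp only: cseq.span_add cseq.span_scale cseq.span_base pseq_in_P_basis)
    then show ?case
      unfolding x using step(2) assms(3) by blast
  qed
  then show ?thesis ..
qed

lemma shift_seq_span_coord:
  assumes "s \<in> cseq.span P_basis"
  shows "shift_seq s \<in> cseq.span P_basis \<and>
    (\<forall>a i. coord (shift_seq s) (pseq a i) = a * coord s (pseq a i) + pfac a * coord s (pseq a (Suc i)))"
  using assms
proof (induction rule: span_coord_induct)
  case zero
  then show ?case by (simp add: cseq.span_zero cseq.representation_zero flip: zero_fun_def)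
next
  case (step c b j w)
  have b: "shift_seq (pseq b j) \<in> cseq.span P_basis"
    unfolding shift_seq_pseq
    by (cases j) (simp_all add: cseq.span_add cseq.span_scale cseq.span_base)
  have c: "coord (shift_seq (pseq b j)) (pseq a i)
      = a * coord (pseq b j) (pseq a i) + pfac a * coord (pseq b j) (pseq a (Suc i))" for a i
    unfolding shift_seq_pseq
    by (cases j)
      (auto simp: coord_add coord_scale coord_pseq cseq.span_scale cseq.span_base)
  let ?v = "seq_scale c (pseq b j) + w"
  have "shift_seq ?v = seq_scale c (shift_seq (pseq b j)) + shift_seq w"
    by (simp only: shift_seq_add shift_seq_scale)
  moreover have "coord ?v v = c * coord (pseq b j) v + coord w v" for v
    using step by (simp add: coord_add coord_scale cseq.span_scale cseq.span_base)
  moreover have "coord (seq_scale c (shift_seq (pseq b j)) + shift_seq w) v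
      = c * coord (shift_seq (pseq b j)) v + coord (shift_seq w) v" for v
    using step b by (simp add: coord_add coord_scale cseq.span_scale)
  moreover have "seq_scale c (shift_seq (pseq b j)) + shift_seq w \<in> cseq.span P_basis"
    using step b by (simp add: cseq.span_add cseq.span_scale)
  ultimately show ?case
    using step by (simp only:) (simp add: c algebra_simps)
qed

lemma shift_act_span:
  assumes "s \<in> cseq.span P_basis"
  shows "shift_act p s \<in> cseq.span P_basis"
proof (induction p)
  case (pCons c p)
  then show ?case
    unfolding shift_act_pCons
    by (intro cseq.span_add cseq.span_scale assms) (simp add: shift_seq_span_coord)
qed (simp add: cseq.span_zero flip: zero_fun_def)

lemma coord_shift_act_linear_power:
  assumes "s \<in> cseq.span P_basis"
  shows "coord (shift_act ([:- a, 1:] ^ n) s) (pseq a i) = pfac a ^ n * coord s (pseq a (i + n))"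
proof (induction n arbitrary: i)
  case (Suc n)
  let ?w = "shift_act ([:- a, 1:] ^ n) s"
  have w: "?w \<in> cseq.span P_basis"
    by (rule shift_act_span[OF assms])
  have "shift_act ([:- a, 1:] ^ Suc n) s = shift_seq ?w + seq_scale (- a) ?w"
    by (simp only: power_Suc shift_act_mult shift_act_linear_poly)
      (simp add: fun_eq_iff seq_scale_def)
  moreover have "coord (shift_seq ?w + seq_scale (- a) ?w) (pseq a i) = pfac a * coord ?w (pseq a (Suc i))"
    using shift_seq_span_coord[OF w] w by (simp add: coord_add coord_scale cseq.span_scale del: cseq.scale_minus_left)
  ultimately have "coord (shift_act ([:- a, 1:] ^ Suc n) s) (pseq a i) = pfac a * coord ?w (pseq a (Suc i))"
    by (simp only:)
  then show ?case
    by (simp add: Suc.IH)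
qed simp

text \<open>
  At the highest index that occurs for an eigenvalue \<open>a\<close>, the action is triangular with
  diagonal entry \<open>p(a)\<close>.
\<close>

lemma coord_shift_act_top:
  assumes s: "s \<in> cseq.span P_basis" and top: "\<And>i. i > m \<Longrightarrow> coord s (pseq a i) = 0"
  shows "coord (shift_act p s) (pseq a m) = poly p a * coord s (pseq a m)"
proof -
  have "coord (shift_act p s) (pseq a m) = poly p a * coord s (pseq a m) \<and>
        (\<forall>i>m. coord (shift_act p s) (pseq a i) = 0)"
  proof (induction p)
    case 0
    then show ?case by (simp add: cseq.representation_zero flip: zero_fun_def)
  next
    case (pCons c p)
    have w: "shift_act p s \<in> cseq.span P_basis"
      by (rule shift_act_span[OF s])
    have "coord (shift_act (pCons c p) s) (pseq a i) = c * coord s (pseq a i)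
        + (a * coord (shift_act p s) (pseq a i) + pfac a * coord (shift_act p s) (pseq a (Suc i)))" for i
      using shift_seq_span_coord[OF w] s
      by (simp add: shift_act_pCons coord_add coord_scale cseq.span_scale)
    then show ?case
      using pCons.IH top by (simp add: algebra_simps)
  qed
  then show ?thesis ..
qed

text \<open>
  Write \<open>p = (X - a)\<^sup>e g\<close> with \<open>g(a) \<noteq> 0\<close>, and let \<open>m \<ge> i\<close> be the highest index of \<open>s\<close> at \<open>a\<close>.
  If \<open>e \<le> m\<close>, then \<open>(E - a)\<^sup>e\<close> moves the coefficient at \<open>m\<close> to \<open>m - e\<close>, where \<open>g(E)\<close> multiplies it by
  \<open>g(a)\<close>, so that \<open>p(E) s\<close> would not vanish.
\<close>

lemma linear_power_dvd_if_killed: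
  assumes s: "s \<in> cseq.span P_basis" and c: "coord s (pseq a i) \<noteq> 0" and p: "shift_act p s = 0"
  shows "[:- a, 1:] ^ Suc i dvd p"
proof (cases "p = 0")
  case False
  define e where "e = order a p"
  obtain g where g: "p = [:- a, 1:] ^ e * g" "\<not> [:- a, 1:] dvd g"
    using order_decomp[OF False] unfolding e_def by blast
  have ga: "poly g a \<noteq> 0"
    using g(2) by (simp add: poly_eq_0_iff_dvd)
  define I where "I = {i. coord s (pseq a i) \<noteq> 0}"
  have "inj (pseq a)"
    by (simp add: inj_def)
  then have "finite (pseq a -` {v. coord s v \<noteq> 0})"
    by (intro finite_vimageI cseq.finite_representation)
  then have fin: "finite I"
    by (simp add: I_def vimage_def)
  define m where "m = Max I"
  have "i \<in> I" using c by (simp add: I_def)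
  then have m: "m \<in> I" "i \<le> m"
    using fin Max_in unfolding m_def by auto
  have top: "coord s (pseq a j) = 0" if "j > m" for j
    using Max_ge[OF fin, of j] that by (force simp: m_def I_def)
  have "m < e"
  proof (rule ccontr)
    assume "\<not> m < e"
    then have em: "e \<le> m" by simp
    let ?w = "shift_act ([:- a, 1:] ^ e) s"
    have w: "?w \<in> cseq.span P_basis"
      by (rule shift_act_span[OF s])
    have "shift_act g ?w = 0"
      using p unfolding g(1) by (metis mult.commute shift_act_mult)
    then have "coord (shift_act g ?w) (pseq a (m - e)) = 0"
      by (simp add: cseq.representation_zero)
    moreover have "coord (shift_act g ?w) (pseq a (m - e)) = poly g a * coord ?w (pseq a (m - e))"
      using em by (intro coord_shift_act_top w) (auto simp: coord_shift_act_linear_power[OF s] top)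
    ultimately show False
      using ga m(1) em by (simp add: coord_shift_act_linear_power[OF s] I_def)
  qed
  then have "Suc i \<le> e" using m(2) by simp
  then show ?thesis
    by (simp only: order_divides e_def) simp
qed simp

section \<open>The entries of the powers of a matrix\<close>

text \<open>
  The scalar sequence formed by the \<open>(r, c)\<close> entries of the powers of \<open>A\<close>.
\<close>

definition entry_seq :: "'a::field mat \<Rightarrow> nat \<Rightarrow> nat \<Rightarrow> (nat \<Rightarrow> 'a)" where
  "entry_seq A r c = (\<lambda>k. (A ^\<^sub>m k) $$ (r, c))"

lemma sum_seq_apply: "(\<Sum>i\<in>I. f i) k = (\<Sum>i\<in>I. f i k)"
  for f :: "'b \<Rightarrow> nat \<Rightarrow> 'a::comm_monoid_add"
  by (induction I rule: infinite_finite_induct) auto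

lemma mult_mat_index_sum:
  assumes "X \<in> carrier_mat q q" "Y \<in> carrier_mat q q" "r < q" "c < q"
  shows "(X * Y) $$ (r, c) = (\<Sum>l<q. X $$ (r, l) * Y $$ (l, c))"
  using assms by (simp add: scalar_prod_def lessThan_atLeast0)

lemma power_mat_add_index:
  assumes A: "A \<in> carrier_mat q q" and rc: "r < q" "c < q"
  shows "(A ^\<^sub>m (k + i)) $$ (r, c) = (\<Sum>l<q. (A ^\<^sub>m k) $$ (r, l) * (A ^\<^sub>m i) $$ (l, c))"
proof -
  have "A ^\<^sub>m (k + i) = A ^\<^sub>m k * A ^\<^sub>m i"
    using A
  proof (induction i)
    case (Suc i)
    then show ?case
      by (simp add: assoc_mult_mat[of _ q q _ q _ q])
  qed simp
  moreover have "A ^\<^sub>m k \<in> carrier_mat q q" "A ^\<^sub>m i \<in> carrier_mat q q"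
    using A by simp_all
  ultimately show ?thesis
    using rc by (simp only: mult_mat_index_sum)
qed

lemma shift_act_entry_seq:
  assumes A: "A \<in> carrier_mat q q" and rc: "r < q" "c < q"
  shows "shift_act p (entry_seq A r c) k = (\<Sum>l<q. (A ^\<^sub>m k) $$ (r, l) * poly_mat p A $$ (l, c))"
proof -
  have "shift_act p (entry_seq A r c) k
      = (\<Sum>i\<le>degree p. \<Sum>l<q. coeff p i * ((A ^\<^sub>m k) $$ (r, l) * (A ^\<^sub>m i) $$ (l, c)))"
    by (simp add: shift_act_def entry_seq_def power_mat_add_index[OF A rc] sum_distrib_left)
  also have "\<dots> = (\<Sum>l<q. \<Sum>i\<le>degree p. (A ^\<^sub>m k) $$ (r, l) * (coeff p i * (A ^\<^sub>m i) $$ (l, c)))"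
    by (subst sum.swap) (simp add: mult_ac)
  also have "\<dots> = (\<Sum>l<q. (A ^\<^sub>m k) $$ (r, l) * poly_mat p A $$ (l, c))"
    using A rc by (intro sum.cong refl) (simp add: poly_mat_def sum_distrib_left)
  finally show ?thesis .
qed

lemma poly_mat_eq_0_iff:
  assumes A: "A \<in> carrier_mat q q"
  shows "poly_mat p A = 0\<^sub>m q q \<longleftrightarrow> (\<forall>r<q. \<forall>c<q. shift_act p (entry_seq A r c) = 0)"
proof
  assume 0: "poly_mat p A = 0\<^sub>m q q"
  show "\<forall>r<q. \<forall>c<q. shift_act p (entry_seq A r c) = 0"
    using A by (auto simp: fun_eq_iff shift_act_entry_seq 0)
next
  assume s: "\<forall>r<q. \<forall>c<q. shift_act p (entry_seq A r c) = 0"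
  show "poly_mat p A = 0\<^sub>m q q"
  proof (rule eq_matI)
    fix r c
    assume "r < dim_row (0\<^sub>m q q :: 'a mat)" "c < dim_col (0\<^sub>m q q :: 'a mat)"
    then have rc: "r < q" "c < q" by simp_all
    then have "shift_act p (entry_seq A r c) 0 = 0"
      using s by simp
    then show "poly_mat p A $$ (r, c) = (0\<^sub>m q q) $$ (r, c)"
      using A rc by (simp add: shift_act_def entry_seq_def poly_mat_def)
  qed (use A in \<open>simp_all add: poly_mat_def\<close>)
qed

text \<open>
  The Cayley--Hamilton theorem in terms of the entry sequences. The rule
  \<open>A\<^bsup>k+1\<^esup> = A\<^sup>k A\<close> says that each row of entry sequences is killed by the polynomial matrix \<open>X - A\<close>,
  acting from the right; hence it is killed by \<open>(X - A) adj(X - A)\<close>, which is the characteristic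
  polynomial times the identity.
\<close>

lemma shift_act_char_poly:
  assumes A: "A \<in> carrier_mat q q" and rc: "r < q" "c < q"
  shows "shift_act (char_poly A) (entry_seq A r c) = 0"
proof -
  define M where "M = char_poly_matrix A"
  define D where "D = adj_mat M"
  have M: "M \<in> carrier_mat q q"
    using A by (simp add: M_def)
  then have D: "D \<in> carrier_mat q q"
    unfolding D_def by (rule adj_mat)
  have M_col: "(\<Sum>l<q. shift_act (M $$ (l, d)) (entry_seq A r l)) = 0" if d: "d < q" for d
  proof
    fix k
    have M_entry: "M $$ (l, d) = (if l = d then [:0, 1:] else 0) + [:- A $$ (l, d):]" if "l < q" for l
      using A d that by (auto simp: M_def char_poly_matrix_def)
    have "(\<Sum>l<q. shift_act (M $$ (l, d)) (entry_seq A r l)) k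
        = (\<Sum>l<q. shift_act (M $$ (l, d)) (entry_seq A r l) k)"
      by (rule sum_seq_apply)
    also have "\<dots> = (\<Sum>l<q. (if l = d then (A ^\<^sub>m (Suc k)) $$ (r, d) else 0)
        - (A ^\<^sub>m k) $$ (r, l) * A $$ (l, d))"
    proof (rule sum.cong[OF refl])
      fix l
      assume "l \<in> {..<q}"
      then have "M $$ (l, d) = (if l = d then [:0, 1:] else 0) + [:- A $$ (l, d):]"
        by (intro M_entry) simp
      then show "shift_act (M $$ (l, d)) (entry_seq A r l) k
          = (if l = d then (A ^\<^sub>m (Suc k)) $$ (r, d) else 0) - (A ^\<^sub>m k) $$ (r, l) * A $$ (l, d)"
        by (simp add: shift_act_add_poly shift_act_def entry_seq_def del: pow_mat.simps)
    qed
    also have "\<dots> = (A ^\<^sub>m (k + 1)) $$ (r, d) - (\<Sum>l<q. (A ^\<^sub>m k) $$ (r, l) * A $$ (l, d))"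
      using d by (simp add: sum_subtractf del: pow_mat.simps)
    also have "\<dots> = 0"
      using A d rc by (subst power_mat_add_index[OF A]) auto
    finally show "(\<Sum>l<q. shift_act (M $$ (l, d)) (entry_seq A r l)) k = 0 k"
      by simp
  qed
  have MD: "(\<Sum>d<q. M $$ (l, d) * D $$ (d, c)) = (if l = c then char_poly A else 0)" if "l < q" for l
  proof -
    have "(M * D) $$ (l, c) = (\<Sum>d<q. M $$ (l, d) * D $$ (d, c))"
      using M D that rc(2) by (rule mult_mat_index_sum)
    moreover have "M * D = char_poly A \<cdot>\<^sub>m 1\<^sub>m q"
      using adj_mat(2)[OF M] by (simp add: D_def M_def char_poly_def)
    ultimately have "(\<Sum>d<q. M $$ (l, d) * D $$ (d, c)) = (char_poly A \<cdot>\<^sub>m 1\<^sub>m q) $$ (l, c)"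
      by (simp only:)
    then show ?thesis
      using that rc by simp
  qed
  have "shift_act (char_poly A) (entry_seq A r c)
      = (\<Sum>l<q. if l = c then shift_act (char_poly A) (entry_seq A r l) else 0)"
    using rc by simp
  also have "\<dots> = (\<Sum>l<q. shift_act (\<Sum>d<q. M $$ (l, d) * D $$ (d, c)) (entry_seq A r l))"
    by (intro sum.cong refl) (simp add: MD)
  also have "\<dots> = (\<Sum>l<q. \<Sum>d<q. shift_act (D $$ (d, c)) (shift_act (M $$ (l, d)) (entry_seq A r l)))"
    by (simp add: shift_act_sum_poly shift_act_mult[symmetric] mult.commute)
  also have "\<dots> = (\<Sum>d<q. shift_act (D $$ (d, c)) (\<Sum>l<q. shift_act (M $$ (l, d)) (entry_seq A r l)))"
    by (subst sum.swap) (simp only: shift_act_sum)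
  also have "\<dots> = (\<Sum>d<q. 0)"
    by (intro sum.cong refl) (simp only: M_col lessThan_iff shift_act_0_right)
  finally show ?thesis by (simp only: sum.neutral_const)
qed

lemma entry_seq_in_span:
  assumes A: "A \<in> carrier_mat q q" and "splits (char_poly A)" and rc: "r < q" "c < q"
  shows "entry_seq A r c \<in> cseq.span P_basis"
proof -
  obtain a as where p: "char_poly A = Polynomial.smult a (\<Prod>b\<leftarrow>as. [:- b, 1:])"
    using assms(2) unfolding splits_def by blast
  have "a \<noteq> 0"
    using degree_monic_char_poly[OF A] p by auto
  then have "(\<Prod>b\<leftarrow>as. [:- b, 1:]) = Polynomial.smult (1 / a) (char_poly A)"
    by (simp add: p)
  then have "shift_act (\<Prod>b\<leftarrow>as. [:- b, 1:]) (entry_seq A r c) = 0"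
    by (simp only: shift_act_smult shift_act_char_poly[OF A rc] cseq.scale_zero_right)
  then show ?thesis
    by (rule in_span_P_basis_if_killed)
qed

section \<open>The canonical form\<close>

lemma geom_seq_eq_pseq: "a \<noteq> 0 \<Longrightarrow> geom_seq a = pseq a 0"
  by (simp add: pseq_def Lambda_seq_def fun_eq_iff)

text \<open>
  Multiplication by \<open>\<Lambda>\<^sub>i\<close> moves the coordinate of a combination of geometric sequences at \<open>a\<close> to
  the basis sequence with index \<open>i\<close> for \<open>a\<close>. This is what reads off a canonical form from coordinates.
\<close>

lemma Lambda_mult_span_star:
  assumes "b \<in> cseq.span S_star"
  shows "Lambda_seq i * b \<in> cseq.span P_basis \<and>
    (\<forall>a j. coord (Lambda_seq i * b) (pseq a j) = (if a \<noteq> 0 \<and> j = i then coord b (pseq a 0) else 0))"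
proof -
  have "b \<in> cseq.span P_basis \<and> Lambda_seq i * b \<in> cseq.span P_basis \<and>
    (\<forall>a j. coord (Lambda_seq i * b) (pseq a j) = (if a \<noteq> 0 \<and> j = i then coord b (pseq a 0) else 0))"
    using assms
  proof (induction rule: cseq.span_induct_alt)
    case base
    have "Lambda_seq i * 0 = (0 :: nat \<Rightarrow> 'a)"
      by simp
    then show ?case
      by (simp add: cseq.span_zero cseq.representation_zero flip: zero_fun_def)
  next
    case (step c x y)
    obtain d where d: "d \<noteq> 0" "x = pseq d 0"
      using step(1) geom_seq_eq_pseq by (auto simp: S_star_def)
    let ?v = "seq_scale c (pseq d 0) + y" and ?w = "seq_scale c (pseq d i) + Lambda_seq i * y"
    have w: "Lambda_seq i * ?v = ?w"
      using d(1) by (auto simp: fun_eq_iff seq_scale_def pseq_def Lambda_seq_def algebra_simps)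
    have y: "y \<in> cseq.span P_basis" "Lambda_seq i * y \<in> cseq.span P_basis"
      using step(2) by blast+
    have "coord ?v v = c * coord (pseq d 0) v + coord y v" for v
      using y(1) by (simp add: coord_add coord_scale cseq.span_scale cseq.span_base)
    moreover have "coord ?w v = c * coord (pseq d i) v + coord (Lambda_seq i * y) v" for v
      using y(2) by (simp add: coord_add coord_scale cseq.span_scale cseq.span_base)
    moreover have "?v \<in> cseq.span P_basis" "?w \<in> cseq.span P_basis"
      using y by (simp_all add: cseq.span_add cseq.span_scale cseq.span_base)
    ultimately show ?case
      unfolding d(2) w using step d(1) by (simp only:) (auto simp: coord_pseq)
  qed
  then show ?thesis by blast
qed

lemma span_star_eqI:
  assumes "b \<in> cseq.span S_star" "b' \<in> cseq.span S_star"
    and "\<And>a. a \<noteq> 0 \<Longrightarrow> coord b (pseq a 0) = coord b' (pseq a 0)"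
  shows "b = b'"
proof -
  have 1: "Lambda_seq 0 * s = s" for s :: "nat \<Rightarrow> 'a"
    by (simp add: fun_eq_iff Lambda_seq_def)
  note b = Lambda_mult_span_star[OF assms(1), of 0, unfolded 1]
    and b' = Lambda_mult_span_star[OF assms(2), of 0, unfolded 1]
  show ?thesis
  proof (rule coord_eqI)
    show "coord b (pseq a i) = coord b' (pseq a i)" for a i
      using b[THEN conjunct2, rule_format, of a i] b'[THEN conjunct2, rule_format, of a i] assms(3)[of a]
      by argo
  qed (use b b' in blast)+
qed

lemma span_circ_coord:
  assumes "n \<in> cseq.span S_circ"
  shows "n \<in> cseq.span P_basis \<and> (\<forall>a j. a \<noteq> 0 \<longrightarrow> coord n (pseq a j) = 0)"
  using assms
proof (induction rule: cseq.span_induct_alt)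
  case base
  then show ?case
    by (simp add: cseq.span_zero cseq.representation_zero flip: zero_fun_def)
next
  case (step c x y)
  obtain i where "x = pseq 0 i"
    using step(1) by (auto simp: S_circ_def pseq_def)
  moreover have "coord (seq_scale c (pseq 0 i) + y) v = c * coord (pseq 0 i) v + coord y v" for v i
    using step by (simp add: coord_add coord_scale cseq.span_scale cseq.span_base)
  moreover have "seq_scale c (pseq 0 i) + y \<in> cseq.span P_basis" for i
    using step by (simp_all add: cseq.span_add cseq.span_scale cseq.span_base)
  ultimately show ?case
    using step by (simp only:) (simp add: coord_pseq)
qed

text \<open>
  The coordinates of a sequence given by a form \<open>n + b 0 \<Lambda>\<^sub>0 + b 1 \<Lambda>\<^sub>1 + \<dots>\<close> are those of its
  constituents; so the form is determined by the sequence.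
\<close>

lemma coord_form:
  assumes n: "n \<in> cseq.span S_circ" and b: "\<And>i. b i \<in> cseq.span S_star"
    and I: "finite I" "\<And>i. i \<notin> I \<Longrightarrow> b i = 0"
    and s: "s = n + (\<Sum>i\<in>I. Lambda_seq i * b i)"
  shows "coord s (pseq a j) = (if a = 0 then coord n (pseq 0 j) else coord (b j) (pseq a 0))"
proof -
  have L: "Lambda_seq i * b i \<in> cseq.span P_basis"
    "coord (Lambda_seq i * b i) (pseq a j) = (if a \<noteq> 0 \<and> j = i then coord (b i) (pseq a 0) else 0)" for i
    using Lambda_mult_span_star[OF b, of i i] by auto
  have "coord s (pseq a j) = coord n (pseq a j) + (\<Sum>i\<in>I. coord (Lambda_seq i * b i) (pseq a j))"
    unfolding s using span_circ_coord[OF n] L(1)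
    by (simp add: coord_add coord_sum cseq.span_sum)
  also have "(\<Sum>i\<in>I. coord (Lambda_seq i * b i) (pseq a j))
      = (\<Sum>i\<in>I. if j = i then (if a \<noteq> 0 then coord (b j) (pseq a 0) else 0) else 0)"
    by (intro sum.cong) (auto simp: L(2))
  also have "\<dots> = (if a \<noteq> 0 then coord (b j) (pseq a 0) else 0)"
    using I by (cases "j \<in> I") (simp_all add: cseq.representation_zero)
  finally show ?thesis
    using span_circ_coord[OF n] by auto
qed

lemma form_exists:
  assumes "s \<in> cseq.span P_basis"
  shows "\<exists>n b m. n \<in> cseq.span S_circ \<and> (\<forall>i. b i \<in> cseq.span S_star) \<and> (\<forall>i\<ge>m. b i = 0) \<and>
    s = n + (\<Sum>i<m. Lambda_seq i * b i)"
  using assms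
proof (induction rule: span_coord_induct)
  case zero
  show ?case
    by (intro exI[of _ 0] exI[of _ "\<lambda>_. 0"] exI[of _ "0 :: nat"])
      (simp add: cseq.span_zero flip: zero_fun_def)
next
  case (step c d j w)
  then obtain n b m where n: "n \<in> cseq.span S_circ" and b: "\<And>i. b i \<in> cseq.span S_star"
    and m: "\<And>i. i \<ge> m \<Longrightarrow> b i = 0" and w: "w = n + (\<Sum>i<m. Lambda_seq i * b i)"
    by blast
  show ?case
  proof (cases "d = 0")
    case True
    have "pseq d j \<in> S_circ"
      using True by (simp add: pseq_def S_circ_def)
    then have "seq_scale c (pseq d j) + n \<in> cseq.span S_circ"
      by (intro cseq.span_add cseq.span_scale n cseq.span_base)
    moreover have "seq_scale c (pseq d j) + w = (seq_scale c (pseq d j) + n) + (\<Sum>i<m. Lambda_seq i * b i)"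
      by (simp only: w add.assoc)
    ultimately show ?thesis
      using b m by blast
  next
    case False
    define b' where "b' i = (if i = j then seq_scale c (geom_seq d) + b i else b i)" for i
    define m' where "m' = max m (Suc j)"
    have "geom_seq d \<in> cseq.span S_star"
      using False by (auto simp: S_star_def intro: cseq.span_base)
    then have b': "b' i \<in> cseq.span S_star" for i
      using b unfolding b'_def by (cases "i = j") (simp_all add: cseq.span_add cseq.span_scale)
    have m': "b' i = 0" if "i \<ge> m'" for i
      using that m[of i] by (simp add: b'_def m'_def)
    have "Lambda_seq i * b' i = (if i = j then seq_scale c (pseq d j) else 0) + Lambda_seq i * b i" for i
      using False by (auto simp: b'_def pseq_def fun_eq_iff seq_scale_def algebra_simps)
    then have "(\<Sum>i<m'. Lambda_seq i * b' i)
        = (\<Sum>i<m'. if i = j then seq_scale c (pseq d j) else 0) + (\<Sum>i<m'. Lambda_seq i * b i)"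
      by (simp only: sum.distrib)
    also have "(\<Sum>i<m'. if i = j then seq_scale c (pseq d j) else 0) = seq_scale c (pseq d j)"
      by (subst sum.delta) (simp_all add: m'_def)
    also have "(\<Sum>i<m'. Lambda_seq i * b i) = (\<Sum>i<m. Lambda_seq i * b i)"
      by (intro sum.mono_neutral_right) (auto simp: m'_def m)
    finally have "seq_scale c (pseq d j) + w = n + (\<Sum>i<m'. Lambda_seq i * b' i)"
      by (simp only: w ac_simps)
    then show ?thesis
      using n b' m' by blast
  qed
qed

lemma mats_over_iff:
  "X \<in> mats_over q V \<longleftrightarrow> X \<in> carrier_mat q q \<and> (\<forall>r<q. \<forall>c<q. X $$ (r, c) \<in> V)"
  unfolding mats_over_def by (auto dest!: elements_matD)

lemma power_seq_mat_index:
  assumes "A \<in> carrier_mat q q" "r < q" "c < q"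
  shows "power_seq_mat A $$ (r, c) = entry_seq A r c"
  using assms by (simp add: power_seq_mat_def entry_seq_def)

lemma pform_value_index:
  assumes "r < q" "c < q" "N \<in> carrier_mat q q" "\<And>i. B i \<in> carrier_mat q q"
  shows "pform_value q (N, B) $$ (r, c) = N $$ (r, c) + (\<Sum>i\<in>pform_support q B. Lambda_seq i * B i $$ (r, c))"
proof -
  have "(Lambda_seq i \<cdot>\<^sub>m B i) $$ (r, c) = Lambda_seq i * B i $$ (r, c)" for i
    using assms(1,2) assms(4)[of i] by simp
  then show ?thesis
    using assms(1,2,3) by (simp add: pform_value_def)
qed

lemma canonical_form_coord:
  assumes A: "A \<in> carrier_mat q q" and f: "is_P_canonical_form A (N, B)" and rc: "r < q" "c < q"
  shows "coord (entry_seq A r c) (pseq a j) =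
    (if a = 0 then coord (N $$ (r, c)) (pseq 0 j) else coord (B j $$ (r, c)) (pseq a 0))"
proof (rule coord_form)
  have N: "N \<in> mats_over q (cseq.span S_circ)" and B: "\<And>i. B i \<in> mats_over q (cseq.span S_star)"
    and fin: "finite (pform_support q B)" and v: "power_seq_mat A = pform_value q (N, B)"
    using f A unfolding is_P_canonical_form_def by auto
  show "N $$ (r, c) \<in> cseq.span S_circ" "B i $$ (r, c) \<in> cseq.span S_star" for i
    using N B rc by (auto simp: mats_over_iff)
  show "finite (pform_support q B)" by (rule fin)
  show "B i $$ (r, c) = 0" if "i \<notin> pform_support q B" for i
    using that rc by (simp add: pform_support_def)
  show "entry_seq A r c = N $$ (r, c) + (\<Sum>i\<in>pform_support q B. Lambda_seq i * B i $$ (r, c))"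
    using rc N B unfolding power_seq_mat_index[OF A rc, symmetric] v
    by (intro pform_value_index) (auto simp: mats_over_iff)
qed

lemma canonical_form_unique:
  assumes A: "A \<in> carrier_mat q q"
    and f: "is_P_canonical_form A (N, B)" "is_P_canonical_form A (N', B')"
  shows "(N, B) = (N', B')"
proof -
  have N: "N \<in> mats_over q (cseq.span S_circ)" "N' \<in> mats_over q (cseq.span S_circ)"
    and B: "B i \<in> mats_over q (cseq.span S_star)" "B' i \<in> mats_over q (cseq.span S_star)" for i
    using f A unfolding is_P_canonical_form_def by auto
  have eq: "(if a = 0 then coord (N $$ (r, c)) (pseq 0 j) else coord (B j $$ (r, c)) (pseq a 0))
      = (if a = 0 then coord (N' $$ (r, c)) (pseq 0 j) else coord (B' j $$ (r, c)) (pseq a 0))"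
    if "r < q" "c < q" for r c a j
    unfolding canonical_form_coord[OF A f(1) that, symmetric]
    by (rule canonical_form_coord[OF A f(2) that])
  have "N = N'"
  proof (rule eq_matI)
    fix r c
    assume "r < dim_row N'" "c < dim_col N'"
    then have rc: "r < q" "c < q"
      using N by (auto simp: mats_over_iff)
    then have s: "N $$ (r, c) \<in> cseq.span S_circ" "N' $$ (r, c) \<in> cseq.span S_circ"
      using N by (auto simp: mats_over_iff)
    show "N $$ (r, c) = N' $$ (r, c)"
    proof (rule coord_eqI)
      show "coord (N $$ (r, c)) (pseq a i) = coord (N' $$ (r, c)) (pseq a i)" for a i
        using span_circ_coord[OF s(1)] span_circ_coord[OF s(2)] eq[OF rc, of 0 i]
        by (cases "a = 0") simp_all
    qed (use span_circ_coord s in blast)+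
  qed (use N in \<open>auto simp: mats_over_iff\<close>)
  moreover have "B i = B' i" for i
  proof (rule eq_matI)
    fix r c
    assume "r < dim_row (B' i)" "c < dim_col (B' i)"
    then have rc: "r < q" "c < q"
      using B(2)[of i] by (auto simp: mats_over_iff)
    show "B i $$ (r, c) = B' i $$ (r, c)"
    proof (rule span_star_eqI)
      show "coord (B i $$ (r, c)) (pseq a 0) = coord (B' i $$ (r, c)) (pseq a 0)" if "a \<noteq> 0" for a
        using eq[OF rc, of a i] that by simp
    qed (use B[of i] rc in \<open>auto simp: mats_over_iff\<close>)
  qed (use B[of i] in \<open>auto simp: mats_over_iff\<close>)
  ultimately show ?thesis by auto
qed

lemma canonical_form_exists:
  assumes A: "A \<in> carrier_mat q q" and "splits (char_poly A)"
  shows "\<exists>N B. is_P_canonical_form A (N, B)"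
proof -
  define Q :: "nat \<Rightarrow> nat \<Rightarrow> (nat \<Rightarrow> 'a) \<times> (nat \<Rightarrow> nat \<Rightarrow> 'a) \<times> nat \<Rightarrow> bool" where
    "Q r c = (\<lambda>(n, b, m). n \<in> cseq.span S_circ \<and> (\<forall>i. b i \<in> cseq.span S_star) \<and>
      (\<forall>i\<ge>m. b i = 0) \<and> entry_seq A r c = n + (\<Sum>i<m. Lambda_seq i * b i))" for r c
  define f where "f r c = (SOME x. Q r c x)" for r c
  have Q_ex: "\<exists>x. Q r c x" if rc: "r < q" "c < q" for r c
  proof -
    obtain n b m where "Q r c (n, b, m)"
      using form_exists[OF entry_seq_in_span[OF assms rc]] unfolding Q_def prod.case by blast
    then show ?thesis ..
  qed
  have Q: "Q r c (f r c)" if "r < q" "c < q" for r c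
    unfolding f_def by (rule someI_ex[OF Q_ex[OF that]])
  define n where "n r c = fst (f r c)" for r c
  define b where "b r c = fst (snd (f r c))" for r c
  define m where "m r c = snd (snd (f r c))" for r c
  have nbm: "n r c \<in> cseq.span S_circ \<and> (\<forall>i. b r c i \<in> cseq.span S_star) \<and>
      (\<forall>i\<ge>m r c. b r c i = 0) \<and> entry_seq A r c = n r c + (\<Sum>i<m r c. Lambda_seq i * b r c i)"
    if "r < q" "c < q" for r c
    using Q[OF that] unfolding Q_def n_def b_def m_def case_prod_unfold .
  note n = nbm[THEN conjunct1] and b = nbm[THEN conjunct2, THEN conjunct1, rule_format]
    and m = nbm[THEN conjunct2, THEN conjunct2, THEN conjunct1, rule_format]
    and e = nbm[THEN conjunct2, THEN conjunct2, THEN conjunct2]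
  define N where "N = mat q q (\<lambda>(r, c). n r c)"
  define B where "B i = mat q q (\<lambda>(r, c). b r c i)" for i
  have N: "N \<in> carrier_mat q q" and B: "B i \<in> carrier_mat q q" for i
    by (simp_all add: N_def B_def)
  \<comment> \<open>A common bound for the supports of the entries, so that the matrix form is finitely supported.\<close>
  define M where "M = (\<Sum>(r, c)\<in>{..<q} \<times> {..<q}. m r c)"
  have M: "m r c \<le> M" if "r < q" "c < q" for r c
    unfolding M_def using that member_le_sum[of "(r, c)" "{..<q} \<times> {..<q}" "\<lambda>(r, c). m r c"] by auto
  have "pform_support q B \<subseteq> {..<M}"
  proof
    fix i
    assume i: "i \<in> pform_support q B"
    show "i \<in> {..<M}"
    proof (rule ccontr)
      assume "i \<notin> {..<M}"
      then have "b r c i = 0" if "r < q" "c < q" for r c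
        using M[OF that] m[OF that, of i] by simp
      then have "B i = 0\<^sub>m q q"
        unfolding B_def by (intro eq_matI) auto
      then show False
        using i by (simp add: pform_support_def)
    qed
  qed
  then have fin: "finite (pform_support q B)"
    using finite_subset by blast
  have "power_seq_mat A = pform_value q (N, B)"
  proof (rule eq_matI)
    fix r c
    assume "r < dim_row (pform_value q (N, B))" "c < dim_col (pform_value q (N, B))"
    then have rc: "r < q" "c < q"
      by (simp_all add: pform_value_def)
    have B_rc: "B i $$ (r, c) = b r c i" for i
      using rc by (simp add: B_def)
    have "(\<Sum>i<m r c. Lambda_seq i * b r c i) = (\<Sum>i\<in>pform_support q B \<inter> {..<m r c}. Lambda_seq i * b r c i)"
    proof (rule sum.mono_neutral_right)
      show "\<forall>i\<in>{..<m r c} - pform_support q B \<inter> {..<m r c}. Lambda_seq i * b r c i = 0"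
        using rc by (auto simp: pform_support_def simp flip: B_rc)
    qed auto
    also have "\<dots> = (\<Sum>i\<in>pform_support q B. Lambda_seq i * b r c i)"
      using fin by (intro sum.mono_neutral_left) (auto simp: m[OF rc])
    finally show "power_seq_mat A $$ (r, c) = pform_value q (N, B) $$ (r, c)"
      using rc N B by (simp only: power_seq_mat_index[OF A rc] pform_value_index e B_rc)
        (simp add: N_def)
  qed (use A in \<open>simp_all add: pform_value_def power_seq_mat_def\<close>)
  then have "is_P_canonical_form A (N, B)"
    unfolding is_P_canonical_form_def using A N B fin n b
    by (auto simp: mats_over_iff N_def B_def)
  then show ?thesis by blast
qed

lemma pform_value_P_canonical_form:
  assumes A: "A \<in> carrier_mat q q" and "splits (char_poly A)"
  shows "pform_value (dim_row A) (P_canonical_form A) = power_seq_mat A"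
proof -
  obtain N B where f: "is_P_canonical_form A (N, B)"
    using canonical_form_exists[OF assms] by blast
  have "P_canonical_form A = (N, B)"
    unfolding P_canonical_form_def
  proof (rule the_equality[where P = "is_P_canonical_form A", OF f])
    fix g
    assume g: "is_P_canonical_form A g"
    obtain N' B' where "g = (N', B')" by (cases g)
    then show "g = (N, B)"
      using canonical_form_unique[OF A _ f] g by blast
  qed
  then show ?thesis
    using f by (simp add: is_P_canonical_form_def)
qed

lemma appears_iff:
  assumes A: "A \<in> carrier_mat q q" and "splits (char_poly A)"
  shows "appears A (pseq a i) \<longleftrightarrow> (\<exists>r<q. \<exists>c<q. coord (entry_seq A r c) (pseq a i) \<noteq> 0)"
proof -
  define X where "X = P_coeff A (pseq a i)"
  have X_eq: "X = map_mat (\<lambda>s. coord s (pseq a i)) (power_seq_mat A)"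
    unfolding X_def P_coeff_def pform_value_P_canonical_form[OF assms] ..
  have dim: "power_seq_mat A \<in> carrier_mat q q"
    using A by (simp add: power_seq_mat_def)
  then have X: "X \<in> carrier_mat q q"
    by (simp add: X_eq)
  have X_index: "X $$ (r, c) = coord (entry_seq A r c) (pseq a i)" if "r < q" "c < q" for r c
    using dim that by (simp add: X_eq power_seq_mat_index[OF A])
  have "X = 0\<^sub>m q q \<longleftrightarrow> (\<forall>r<q. \<forall>c<q. coord (entry_seq A r c) (pseq a i) = 0)"
  proof
    assume "X = 0\<^sub>m q q"
    then show "\<forall>r<q. \<forall>c<q. coord (entry_seq A r c) (pseq a i) = 0"
      by (simp flip: X_index)
  next
    assume "\<forall>r<q. \<forall>c<q. coord (entry_seq A r c) (pseq a i) = 0"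
    then show "X = 0\<^sub>m q q"
      using X by (intro eq_matI) (simp_all add: X_index)
  qed
  then show ?thesis
    using A by (auto simp: appears_def X_def)
qed

section \<open>The minimal polynomial\<close>

lemma prod_linear_powers_dvd:
  fixes p :: "'a::field poly"
  assumes "finite S" and "\<And>a. a \<in> S \<Longrightarrow> [:- a, 1:] ^ n a dvd p"
  shows "(\<Prod>a\<in>S. [:- a, 1:] ^ n a) dvd p"
proof (cases "p = 0")
  case False
  show ?thesis
    using assms
  proof (induction S rule: finite_induct)
    case (insert a S)
    let ?P = "\<Prod>b\<in>S. [:- b, 1:] ^ n b"
    obtain h where h: "p = ?P * h"
      using insert by (auto simp: dvd_def)
    have "poly ?P a \<noteq> 0"
      using insert.hyps by (auto simp: poly_prod)
    then have "order a ?P = 0"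
      by (rule order_0I)
    moreover have "order a p = order a ?P + order a h"
      using False unfolding h by (rule order_mult)
    moreover have "n a \<le> order a p"
      using insert.prems[of a] False by (simp add: order_divides)
    ultimately have "[:- a, 1:] ^ n a dvd h"
      by (simp add: order_divides)
    then have "?P * [:- a, 1:] ^ n a dvd p"
      unfolding h by (rule mult_dvd_mono[OF dvd_refl])
    then show ?case
      using insert.hyps by (simp add: mult.commute)
  qed simp
qed simp

text \<open>
  A monic annihilator dividing all annihilators is the unique monic one of least degree.
\<close>

lemma min_poly_eqI:
  assumes "lead_coeff m = 1" and "poly_mat m A = 0\<^sub>m (dim_row A) (dim_row A)"
    and dvd: "\<And>g. poly_mat g A = 0\<^sub>m (dim_row A) (dim_row A) \<Longrightarrow> m dvd g"
  shows "min_poly A = m"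
  unfolding min_poly_def
proof (rule the_equality)
  show "lead_coeff m = 1 \<and> poly_mat m A = 0\<^sub>m (dim_row A) (dim_row A) \<and>
    (\<forall>g. g \<noteq> 0 \<and> poly_mat g A = 0\<^sub>m (dim_row A) (dim_row A) \<longrightarrow> degree m \<le> degree g)"
    using assms by (auto intro: dvd_imp_degree_le)
next
  fix p
  assume p: "lead_coeff p = 1 \<and> poly_mat p A = 0\<^sub>m (dim_row A) (dim_row A) \<and>
    (\<forall>g. g \<noteq> 0 \<and> poly_mat g A = 0\<^sub>m (dim_row A) (dim_row A) \<longrightarrow> degree p \<le> degree g)"
  then obtain h where h: "p = m * h"
    using dvd[of p] by (auto simp: dvd_def)
  have "m \<noteq> 0" "p \<noteq> 0"
    using assms(1) p by auto
  then have "degree p \<le> degree m"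
    using p assms(2) by blast
  then have "degree h = 0"
    using \<open>m \<noteq> 0\<close> \<open>p \<noteq> 0\<close> by (auto simp: h degree_mult_eq)
  then obtain c where c: "h = [:c:]"
    by (rule degree_eq_zeroE)
  have "lead_coeff p = lead_coeff m * lead_coeff h"
    unfolding h by (rule lead_coeff_mult)
  then have "c = 1"
    using p assms(1) by (simp add: c)
  then show "p = m"
    by (simp add: h c)
qed

text \<open>
  For a finite nonempty set of indices, the greatest \<open>n \<ge> 1\<close> such that \<open>n - 1\<close> belongs to the set is
  the successor of its maximum.
\<close>

lemma Greatest_pred:
  assumes "finite {i. P i}" and "\<exists>i. P i"
  defines "g \<equiv> GREATEST n. n \<ge> 1 \<and> P (n - 1)"
  shows "g \<ge> 1" "P (g - 1)" "\<And>i. P i \<Longrightarrow> Suc i \<le> g"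
proof -
  obtain i where i: "P i" using assms(2) by blast
  have bound: "n \<le> Suc (Max {i. P i})" if "n \<ge> 1 \<and> P (n - 1)" for n
    using that Max_ge[OF assms(1), of "n - 1"] by auto
  have "g \<ge> 1 \<and> P (g - 1)"
    unfolding g_def by (rule GreatestI_nat[where k = "Suc i", OF _ bound]) (simp_all add: i)
  then show "g \<ge> 1" "P (g - 1)" by simp_all
  show "Suc j \<le> g" if "P j" for j
    unfolding g_def by (rule Greatest_le_nat[OF _ bound]) (simp_all add: that)
qed

theorem corollary3p6:
  fixes A :: "'a::field mat" and q :: nat
    and L :: "'a set" and t0 :: nat and t :: "'a \<Rightarrow> nat"
  assumes "A \<in> carrier_mat q q"
    and "splits (char_poly A)"
    and "L = {x. x \<noteq> 0 \<and> (\<exists>i. appears A (geom_seq x * Lambda_seq i))}"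
    and "t0 = (if \<exists>i. appears A (zero_seq i)
               then GREATEST n. n \<ge> 1 \<and> appears A (zero_seq (n - 1)) else 0)"
    and "\<And>x. x \<in> L \<Longrightarrow>
           t x = (GREATEST n. n \<ge> 1 \<and> appears A (geom_seq x * Lambda_seq (n - 1)))"
  shows "min_poly A = [:0, 1:] ^ t0 * (\<Prod>x\<in>L. [:- x, 1:] ^ t x)"
proof -
  let ?e = "entry_seq A" and ?app = "\<lambda>a i. appears A (pseq a i)"
  note A = assms(1)
  have span: "?e r c \<in> cseq.span P_basis" if "r < q" "c < q" for r c
    by (rule entry_seq_in_span[OF A assms(2) that])
  have app: "?app a i \<longleftrightarrow> (\<exists>r<q. \<exists>c<q. coord (?e r c) (pseq a i) \<noteq> 0)" for a i
    by (rule appears_iff[OF A assms(2)])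
  have pseq_0: "pseq 0 i = zero_seq i" for i
    by (simp add: pseq_def)
  have pseq_L: "pseq a i = geom_seq a * Lambda_seq i" if "a \<noteq> 0" for a i
    using that by (simp add: pseq_def)
  define K where "K = {(a, i). ?app a i}"
  have "K = (\<lambda>(a, i). pseq a i) -` (\<Union>r<q. \<Union>c<q. {v. coord (?e r c) v \<noteq> 0})"
    by (simp add: K_def app set_eq_iff Bex_def)
  moreover have "finite (\<Union>r<q. \<Union>c<q. {v. coord (?e r c) v \<noteq> 0})"
    by (intro finite_UN_I finite_lessThan cseq.finite_representation)
  moreover have "inj (\<lambda>(a, i). pseq a i :: nat \<Rightarrow> 'a)"
    by (auto simp: inj_def)
  ultimately have finK: "finite K"
    by (simp only: finite_vimageI)
  have fin_app: "finite {i. ?app a i}" for a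
  proof (rule finite_subset)
    show "{i. ?app a i} \<subseteq> snd ` K"
      by (force simp: K_def)
  qed (simp add: finK)
  have L: "L = {a. a \<noteq> 0 \<and> (\<exists>i. ?app a i)}"
    unfolding assms(3) by (simp add: pseq_L cong: conj_cong)
  have "L \<subseteq> fst ` K"
    by (force simp: L K_def)
  then have finL: "finite L"
    by (rule finite_subset) (simp add: finK)
  have "0 \<notin> L"
    by (simp add: L)
  \<comment> \<open>The exponents of all factors, the one at the eigenvalue \<open>0\<close> included.\<close>
  define T where "T a = (if a = 0 then t0 else t a)" for a
  define m where "m = (\<Prod>a\<in>insert 0 L. [:- a, 1:] ^ T a)"
  have m: "m = [:0, 1:] ^ t0 * (\<Prod>x\<in>L. [:- x, 1:] ^ t x)"
  proof -
    have "(\<Prod>a\<in>L. [:- a, 1:] ^ T a) = (\<Prod>x\<in>L. [:- x, 1:] ^ t x)"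
      using \<open>0 \<notin> L\<close> by (intro prod.cong) (auto simp: T_def)
    then show ?thesis
      using finL \<open>0 \<notin> L\<close> by (simp add: m_def T_def)
  qed
  have T_eq: "T a = (GREATEST n. n \<ge> 1 \<and> ?app a (n - 1))" if "\<exists>i. ?app a i" for a
  proof (cases "a = 0")
    case True
    then show ?thesis
      using that by (simp add: T_def assms(4) pseq_0)
  next
    case False
    then have "a \<in> L"
      using that by (auto simp: L)
    then show ?thesis
      using False by (simp add: T_def assms(5) pseq_L)
  qed
  have T_ge: "Suc i \<le> T a" if "?app a i" for a i
  proof -
    have ex: "\<exists>i. ?app a i" using that by blast
    show ?thesis
      unfolding T_eq[OF ex] by (rule Greatest_pred(3)[where P = "?app a", OF fin_app ex that])
  qed
  have T_witness: "T a = 0 \<or> (\<exists>i. T a = Suc i \<and> ?app a i)" if "a \<in> insert 0 L" for a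
  proof (cases "\<exists>i. ?app a i")
    case True
    have "1 \<le> T a" "?app a (T a - 1)"
      unfolding T_eq[OF True] by (rule Greatest_pred[where P = "?app a", OF fin_app True])+
    then show ?thesis
      by (intro disjI2 exI[of _ "T a - 1"]) simp
  next
    case False
    then have "a = 0"
      using that by (auto simp: L)
    then show ?thesis
      using False by (simp add: T_def assms(4) pseq_0)
  qed
  have kill: "shift_act m (?e r c) = 0" if rc: "r < q" "c < q" for r c
  proof -
    have "shift_act m (seq_scale (coord (?e r c) v) v) = 0" if v: "coord (?e r c) v \<noteq> 0" for v
    proof -
      obtain a i where ai: "v = pseq a i"
        using cseq.representation_ne_zero[OF v] unfolding P_basis_eq by auto
      then have "?app a i"
        using v rc app by blast
      then have "a \<in> insert 0 L"
        by (auto simp: L)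
      have "[:- a, 1:] ^ Suc i dvd [:- a, 1:] ^ T a"
        by (intro le_imp_power_dvd T_ge \<open>?app a i\<close>)
      also have "\<dots> dvd m"
        unfolding m_def using finL \<open>a \<in> insert 0 L\<close> by (intro dvd_prodI) auto
      finally show ?thesis
        by (simp only: ai shift_act_scale shift_act_pseq_eq_0 cseq.scale_zero_right)
    qed
    then have "(\<Sum>v | coord (?e r c) v \<noteq> 0. shift_act m (seq_scale (coord (?e r c) v) v)) = 0"
      by (intro sum.neutral) blast
    then show ?thesis
      by (subst coord_expansion[OF span[OF rc]]) (simp only: shift_act_sum)
  qed
  have "min_poly A = m"
  proof (rule min_poly_eqI)
    show "lead_coeff m = 1"
      by (simp add: m_def lead_coeff_prod lead_coeff_power)
    show "poly_mat m A = 0\<^sub>m (dim_row A) (dim_row A)"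
      using A kill poly_mat_eq_0_iff[OF A] by simp
    fix g
    assume "poly_mat g A = 0\<^sub>m (dim_row A) (dim_row A)"
    then have g: "shift_act g (?e r c) = 0" if "r < q" "c < q" for r c
      using A that poly_mat_eq_0_iff[OF A] by simp
    show "m dvd g"
      unfolding m_def
    proof (rule prod_linear_powers_dvd)
      fix a
      assume "a \<in> insert 0 L"
      from T_witness[OF this] show "[:- a, 1:] ^ T a dvd g"
      proof
        assume "\<exists>i. T a = Suc i \<and> ?app a i"
        then obtain i r c where "T a = Suc i" "r < q" "c < q" "coord (?e r c) (pseq a i) \<noteq> 0"
          using app by blast
        then show ?thesis
          using linear_power_dvd_if_killed[OF span _ g] by metis
      qed simp
    qed (simp add: finL)
  qed
  then show ?thesis
    by (simp only: m)
qed

end
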